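(* Let $\tau\in I_n$ be an involution and let $\Phi(\tau)=(M,\lambda)$ be the associated labelled Motzkin path. Then $\tau$ avoids the pattern $3412$ if and only if $\lambda$ is the maximal labelling, i.e. the label of every down step of $M$ equals its height.
   Context: $I_n$ is the set of involutions in the symmetric group $S_n$. A permutation $\sigma\in S_n$ contains the pattern $\pi\in S_k$ if there are $1\le i_1<\dots<i_k\le n$ such that $(\sigma(i_1),\dots,\sigma(i_k))$ is order-isomorphic to $\pi$; otherwise $\sigma$ avoids $\pi$. A Motzkin path of length $n$ is a lattice path from $(0,0)$ to $(n,0)$ never going below the $x$-axis, with up steps $U=(1,1)$, horizontal steps $H=(1,0)$ and down steps $D=(1,-1)$. The height of a step is the larger $y$-coordinate of the step. A labelling of a Motzkin path $M$ is a map $\lambda$ assigning to every down step $D$ at height $h$ an integer $\lambda(D)$ with $1\le\lambda(D)\le h$; the pair $(M,\lambda)$ is a labelled Motzkin path. The maximal labelling $\mu$ assigns to every down step its height. The bijection $\Phi$ from $I_n$ to the set of labelled Motzkin paths of length $n$: given $\tau\in I_n$, start with the empty path and the list $A_\tau$ of the elements of $\{i:\tau(i)>i\}$ in increasing order. For $i=1,\dots,n$ in order: if $\tau(i)=i$, the $i$-th step is $H$; if $\tau(i)>i$, the $i$-th step is $U$; if $\tau(i)<i$, the $i$-th step is $D$, it is given as label the position $k$ of $\tau(i)$ in the current list $A_\tau$, and then $\tau(i)$ is removed from $A_\tau$. The result is $\Phi(\tau)$. *)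

theory Defs
  imports "HOL-Combinatorics.Permutations"
begin

definition involutions :: "nat \<Rightarrow> (nat \<Rightarrow> nat) set" where
  "involutions n = {\<tau>. \<tau> permutes {1..n} \<and> \<tau> \<circ> \<tau> = id}"

text \<open>The permutation of \<open>{1..k}\<close> with the given one-line notation, for a word of length \<open>k\<close>.\<close>
definition of_one_line :: "nat list \<Rightarrow> nat \<Rightarrow> nat" where
  "of_one_line w i = (if i \<in> {1..length w} then w ! (i - 1) else i)"

definition contains_pattern ::
  "nat \<Rightarrow> (nat \<Rightarrow> nat) \<Rightarrow> nat \<Rightarrow> (nat \<Rightarrow> nat) \<Rightarrow> bool" where
  "contains_pattern n \<sigma> k \<pi> \<longleftrightarrow>
     (\<exists>f. strict_mono_on {1..k} f \<and> f ` {1..k} \<subseteq> {1..n} \<and>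
          (\<forall>a\<in>{1..k}. \<forall>b\<in>{1..k}. \<sigma> (f a) < \<sigma> (f b) \<longleftrightarrow> \<pi> a < \<pi> b))"

definition avoids_pattern ::
  "nat \<Rightarrow> (nat \<Rightarrow> nat) \<Rightarrow> nat \<Rightarrow> (nat \<Rightarrow> nat) \<Rightarrow> bool" where
  "avoids_pattern n \<sigma> k \<pi> \<longleftrightarrow> \<not> contains_pattern n \<sigma> k \<pi>"

datatype step = Up | Level | Down

primrec rise :: "step \<Rightarrow> int" where
  "rise Up = 1"
| "rise Level = 0"
| "rise Down = - 1"

text \<open>The path visits the points \<open>(i, ycoord M i)\<close> for \<open>i \<le> length M\<close>. Its steps are numbered
  from 1, so that step \<open>i\<close> is \<open>M ! (i - 1)\<close> and joins the points with abscissae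
  \<open>i - 1\<close> and \<open>i\<close>.\<close>
definition ycoord :: "step list \<Rightarrow> nat \<Rightarrow> int" where
  "ycoord M i = (\<Sum>s\<leftarrow>take i M. rise s)"

definition motzkin_paths :: "nat \<Rightarrow> step list set" where
  "motzkin_paths n = {M. length M = n \<and> (\<forall>i\<le>n. 0 \<le> ycoord M i) \<and> ycoord M n = 0}"

definition step_height :: "step list \<Rightarrow> nat \<Rightarrow> int" where
  "step_height M i = max (ycoord M (i - 1)) (ycoord M i)"

definition down_steps :: "step list \<Rightarrow> nat set" where
  "down_steps M = {i \<in> {1..length M}. M ! (i - 1) = Down}"

text \<open>A labelling is a partial function on step numbers, defined exactly on the down steps.\<close>
type_synonym labelling = "nat \<rightharpoonup> int"

definition labellings :: "step list \<Rightarrow> labelling set" where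
  "labellings M =
     {l. dom l = down_steps M \<and> (\<forall>i\<in>down_steps M. the (l i) \<in> {1..step_height M i})}"

definition labelled_motzkin_paths :: "nat \<Rightarrow> (step list \<times> labelling) set" where
  "labelled_motzkin_paths n = {(M, l). M \<in> motzkin_paths n \<and> l \<in> labellings M}"

definition maximal_labelling :: "step list \<Rightarrow> labelling" where
  "maximal_labelling M i = (if i \<in> down_steps M then Some (step_height M i) else None)"

text \<open>Positions in a list are counted from 1; only used for \<open>x \<in> set xs\<close>.\<close>
definition position :: "'a \<Rightarrow> 'a list \<Rightarrow> nat" where
  "position x xs = Suc (length (takeWhile (\<lambda>y. y \<noteq> x) xs))"

text \<open>The state consists of the current list, the path and the labels built so far.\<close>
fun Phi_step ::
  "(nat \<Rightarrow> nat) \<Rightarrow> nat \<Rightarrow> nat list \<times> step list \<times> labelling \<Rightarrow> nat list \<times> step list \<times> labelling" where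
  "Phi_step \<tau> i (A, M, l) =
     (if \<tau> i = i then (A, M @ [Level], l)
      else if \<tau> i > i then (A, M @ [Up], l)
      else (remove1 (\<tau> i) A, M @ [Down], l(i \<mapsto> int (position (\<tau> i) A))))"

definition Phi :: "nat \<Rightarrow> (nat \<Rightarrow> nat) \<Rightarrow> step list \<times> labelling" where
  "Phi n \<tau> =
     snd (fold (Phi_step \<tau>) [1..<Suc n] (sorted_list_of_set {i \<in> {1..n}. \<tau> i > i}, [], Map.empty))"

lemma position_sorted:
  assumes "sorted xs" "distinct xs" "x \<in> set xs"
  shows "position x xs = card {y \<in> set xs. y \<le> x}"
  using assms
proof (induction xs)
  case (Cons a xs)
  show ?case
  proof (cases "a = x")
    case True
    then have "{y \<in> set (a # xs). y \<le> x} = {x}" using Cons.prems by force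
    then show ?thesis using True by (simp add: position_def)
  next
    case False
    then have x: "x \<in> set xs" and ax: "a \<le> x" using Cons.prems by auto
    have "{y \<in> set (a # xs). y \<le> x} = insert a {y \<in> set xs. y \<le> x}" using ax by auto
    moreover have "a \<notin> set xs" using Cons.prems by simp
    moreover have "position x (a # xs) = Suc (position x xs)" using False by (simp add: position_def)
    ultimately show ?thesis using Cons x by simp
  qed
qed simp

text \<open>Closed forms of the three components of the state after step \<open>i\<close>.\<close>
definition unmatched :: "nat \<Rightarrow> (nat \<Rightarrow> nat) \<Rightarrow> nat \<Rightarrow> nat set" where
  "unmatched n \<tau> i = {j \<in> {1..n}. \<tau> j > j \<and> \<tau> j > (i::nat)}"

definition step_of :: "(nat \<Rightarrow> nat) \<Rightarrow> nat \<Rightarrow> step" where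
  "step_of \<tau> j = (if \<tau> j = j then Level else if \<tau> j > (j::nat) then Up else Down)"

definition labels_upto :: "nat \<Rightarrow> (nat \<Rightarrow> nat) \<Rightarrow> nat \<Rightarrow> labelling" where
  "labels_upto n \<tau> i j = (if 1 \<le> j \<and> j \<le> i \<and> \<tau> j < (j::nat)
   then Some (int (card {k \<in> unmatched n \<tau> (j - 1). k \<le> \<tau> j})) else None)"

lemma involutions_facts:
  assumes "\<tau> \<in> involutions n"
  shows "\<tau> (\<tau> j) = j" "(j::nat) \<in> {1..n} \<Longrightarrow> \<tau> j \<in> {1..n}"
  using assms permutes_in_image[of \<tau> "{1..n}" j] unfolding involutions_def
  by (auto simp: fun_eq_iff)

lemma Phi_state:
  assumes t: "\<tau> \<in> involutions n" and i: "i \<le> n"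
  shows "fold (Phi_step \<tau>) [1..<Suc i] (sorted_list_of_set {i \<in> {1..n}. \<tau> i > i}, [], Map.empty)
    = (sorted_list_of_set (unmatched n \<tau> i), map (step_of \<tau>) [1..<Suc i], labels_upto n \<tau> i)"
  using i
proof (induction i)
  case 0
  have "unmatched n \<tau> 0 = {i \<in> {1..n}. \<tau> i > i}" by (auto simp: unmatched_def)
  then show ?case by (auto simp: labels_upto_def fun_eq_iff)
next
  case (Suc i)
  note IH = Suc.IH[OF Suc_leD[OF Suc.prems]]
  let ?j = "Suc i"
  have tt: "\<tau> (\<tau> k) = k" for k using involutions_facts(1)[OF t] .
  have fin: "finite (unmatched n \<tau> k)" for k by (simp add: unmatched_def)
  have jn: "?j \<in> {1..n}" using Suc.prems by simp
  have [simp]: "[Suc 0..<Suc (Suc i)] = [Suc 0..<Suc i] @ [Suc i]" by simp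
  have op: "unmatched n \<tau> ?j = unmatched n \<tau> i - {\<tau> ?j}"
    using tt unfolding unmatched_def by (auto simp: Suc_lessI) (metis Suc_lessI tt)
  show ?case
  proof (cases "\<tau> ?j < ?j")
    case True
    have mem: "\<tau> ?j \<in> unmatched n \<tau> i" using True involutions_facts(2)[OF t jn] tt by (auto simp: unmatched_def)
    have l: "labels_upto n \<tau> ?j = (labels_upto n \<tau> i)(?j \<mapsto> int (position (\<tau> ?j) (sorted_list_of_set (unmatched n \<tau> i))))"
      using True mem fin by (auto simp: labels_upto_def fun_eq_iff position_sorted)
    show ?thesis using IH True l op fin by (simp add: sorted_list_of_set_remove step_of_def fun_eq_iff del: upt_Suc)
  next
    case False
    then have "\<tau> ?j \<notin> unmatched n \<tau> i" using tt by (auto simp: unmatched_def)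
    then have "unmatched n \<tau> ?j = unmatched n \<tau> i" using op by simp
    moreover have "labels_upto n \<tau> ?j = labels_upto n \<tau> i" using False by (auto simp: labels_upto_def fun_eq_iff le_Suc_eq)
    ultimately show ?thesis using IH False by (simp add: step_of_def del: upt_Suc)
  qed
qed

lemma ycoord_eq_card:
  assumes t: "\<tau> \<in> involutions n" and i: "i \<le> n"
  shows "ycoord (map (step_of \<tau>) [1..<Suc n]) i = int (card {j \<in> unmatched n \<tau> i. j \<le> i})"
  using i
proof (induction i)
  case 0
  have "{j \<in> unmatched n \<tau> 0. j \<le> 0} = {}" by (auto simp: unmatched_def)
  then show ?case by (simp add: ycoord_def)
next
  case (Suc i)
  let ?j = "Suc i"
  let ?S = "\<lambda>i. {j \<in> unmatched n \<tau> i. j \<le> i}"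
  have tt: "\<tau> (\<tau> k) = k" for k using involutions_facts(1)[OF t] .
  have fin: "finite (?S k)" for k by (simp add: unmatched_def)
  have jn: "?j \<in> {1..n}" using Suc.prems by simp
  have y: "ycoord (map (step_of \<tau>) [1..<Suc n]) ?j = int (card (?S i)) + rise (step_of \<tau> ?j)"
    using Suc by (simp add: ycoord_def take_Suc_conv_app_nth del: upt_Suc)
  consider "\<tau> ?j = ?j" | "\<tau> ?j > ?j" | "\<tau> ?j < ?j" by linarith
  then show ?case
  proof cases
    case 1
    have "\<tau> x \<noteq> ?j" if "x \<le> i" for x using that 1 tt by (metis Suc_n_not_le_n)
    then have "Suc i < \<tau> x" if "x \<le> i" "i < \<tau> x" for x using that by (metis Suc_lessI)
    then have "?S ?j = ?S i" using 1 unfolding unmatched_def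
      by (auto simp: le_Suc_eq)
    then show ?thesis unfolding y using 1 fin by (simp add: step_of_def)
  next
    case 2
    have "\<tau> x \<noteq> ?j" if "x \<le> i" for x using that 2 tt by (metis Suc_n_not_le_n le_trans less_imp_le)
    then have "Suc i < \<tau> x" if "x \<le> i" "i < \<tau> x" for x using that by (metis Suc_lessI)
    then have "?S ?j = insert ?j (?S i)" using 2 jn unfolding unmatched_def
      by (auto simp: le_Suc_eq)
    moreover have "?j \<notin> ?S i" by simp
    ultimately show ?thesis unfolding y using 2 fin by (simp add: step_of_def)
  next
    case 3
    have "?S i = insert (\<tau> ?j) (?S ?j)" using tt 3 involutions_facts(2)[OF t jn] unfolding unmatched_def
      by (auto simp: le_Suc_eq) (metis Suc_lessI tt)
    moreover have "\<tau> ?j \<notin> ?S ?j" using tt by (simp add: unmatched_def)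
    ultimately show ?thesis unfolding y using 3 fin by (simp add: step_of_def)
  qed
qed

lemma Phi_in_labelled_motzkin_paths:
  assumes t: "\<tau> \<in> involutions n"
  shows "Phi n \<tau> \<in> labelled_motzkin_paths n"
proof -
  let ?M = "map (step_of \<tau>) [1..<Suc n]"
  have P: "Phi n \<tau> = (?M, labels_upto n \<tau> n)" using Phi_state[OF t order_refl] by (simp add: Phi_def)
  have tt: "\<tau> (\<tau> k) = k" for k using involutions_facts(1)[OF t] .
  have "{j \<in> unmatched n \<tau> n. j \<le> n} = {}" using involutions_facts(2)[OF t] by (force simp: unmatched_def)
  then have "?M \<in> motzkin_paths n" using ycoord_eq_card[OF t] by (auto simp: motzkin_paths_def)
  moreover have ds: "down_steps ?M = {i \<in> {1..n}. \<tau> i < i}"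
    by (auto simp: down_steps_def step_of_def split: if_splits simp del: upt_Suc)
  moreover have "the (labels_upto n \<tau> n i) \<in> {1..step_height ?M i}" if i: "i \<in> {1..n}" "\<tau> i < i" for i
  proof -
    let ?A = "{k \<in> unmatched n \<tau> (i - 1). k \<le> \<tau> i}" and ?B = "{j \<in> unmatched n \<tau> (i - 1). j \<le> i - 1}"
    have "finite ?A" "\<tau> i \<in> ?A" using i tt involutions_facts(2)[OF t i(1)] by (auto simp: unmatched_def)
    then have "card ?A \<ge> 1" by (metis One_nat_def Suc_leI card_gt_0_iff empty_iff)
    moreover have "card ?A \<le> card ?B" using i by (intro card_mono) (auto simp: unmatched_def)
    moreover have "int (card ?B) \<le> step_height ?M i"
      using ycoord_eq_card[OF t, of "i - 1"] i by (simp add: step_height_def del: upt_Suc)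
    ultimately show ?thesis using i by (simp add: labels_upto_def)
  qed
  moreover have "dom (labels_upto n \<tau> n) = {i \<in> {1..n}. \<tau> i < i}"
    by (auto simp: labels_upto_def dom_def split: if_splits)
  ultimately show ?thesis by (auto simp: P labelled_motzkin_paths_def labellings_def)
qed

end

theory Submission
  imports Defs
begin

text \<open>
  View an involution as a diagram of arcs joining \<open>a\<close> to \<open>\<tau> a\<close> for \<open>a < \<tau> a\<close>. Both sides of the
  equivalence say that no two arcs cross, i.e. that there are no \<open>a < b < \<tau> a < \<tau> b\<close>.

  When the arc ending at \<open>j\<close> is closed, the height of the down step counts all arcs that are open
  just before \<open>j\<close>, whereas the label counts only those that start no later than \<open>\<tau> j\<close>. The two
  numbers differ exactly when some open arc starts strictly between \<open>\<tau> j\<close> and \<open>j\<close>; such an arc ends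
  after \<open>j\<close> and so crosses the arc of \<open>j\<close> (\<open>label_eq_height_iff\<close>).

  A crossing is itself an occurrence of \<open>3412\<close> at the four end points. An occurrence of \<open>3412\<close> need
  not consist of two arcs, but it still forces a crossing. If \<open>p < q\<close> are not inverted by a \<open>\<tau>\<close>
  without crossings, then \<open>\<tau> p \<le> q\<close>, since otherwise \<open>p < q < \<tau> p < \<tau> q\<close>. The same remark about
  the non-inverted pair \<open>\<tau> r < \<tau> s\<close> gives \<open>r \<le> \<tau> s\<close>. In an occurrence \<open>p < q < r < s\<close> this would
  give the contradiction \<open>r \<le> \<tau> s < \<tau> p \<le> q < r\<close> (\<open>contains_3412_iff_crossing\<close>).
\<close>

definition crossing_arcs :: "(nat \<Rightarrow> nat) \<Rightarrow> nat \<Rightarrow> nat \<Rightarrow> bool" where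
  "crossing_arcs \<tau> a b \<longleftrightarrow> a < b \<and> b < \<tau> a \<and> \<tau> a < \<tau> b"

lemma involutions_moved:
  assumes "\<tau> \<in> involutions n" "\<tau> k \<noteq> k"
  shows "k \<in> {1..n}"
  using assms unfolding involutions_def by (blast dest: permutes_not_in)

lemma contains_3412_iff:
  "contains_pattern n \<sigma> 4 (of_one_line [3, 4, 1, 2]) \<longleftrightarrow>
    (\<exists>p q r s. 1 \<le> p \<and> p < q \<and> q < r \<and> r < s \<and> s \<le> n \<and>
       \<sigma> r < \<sigma> s \<and> \<sigma> s < \<sigma> p \<and> \<sigma> p < \<sigma> q)" (is "?L \<longleftrightarrow> ?R")
proof -
  have I: "{1..4::nat} = {1, 2, 3, 4}" by auto
  have w: "of_one_line [a, b, c, d] 1 = a" "of_one_line [a, b, c, d] 2 = b"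
    "of_one_line [a, b, c, d] 3 = c" "of_one_line [a, b, c, d] 4 = d" for a b c d
    by (simp_all add: of_one_line_def)
  show ?thesis
  proof
    assume ?L
    then obtain f where mono: "strict_mono_on {1..4::nat} f" and ran: "f ` {1..4} \<subseteq> {1..n}"
      and ord: "\<forall>a\<in>{1..4}. \<forall>b\<in>{1..4}.
        \<sigma> (f a) < \<sigma> (f b) \<longleftrightarrow> of_one_line [3, 4, 1, 2] a < of_one_line [3, 4, 1, 2] b"
      unfolding contains_pattern_def by blast
    have "f 1 < f 2" "f 2 < f 3" "f 3 < f 4"
      by (rule strict_mono_onD[OF mono]; simp)+
    moreover have "1 \<le> f 1" "f 4 \<le> n" using ran unfolding I by auto
    moreover have "\<sigma> (f 3) < \<sigma> (f 4)" "\<sigma> (f 4) < \<sigma> (f 1)" "\<sigma> (f 1) < \<sigma> (f 2)"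
      using ord[rule_format, of 3 4] ord[rule_format, of 4 1] ord[rule_format, of 1 2]
      unfolding w by simp_all
    ultimately show ?R by blast
  next
    assume ?R
    then obtain p q r s where o: "1 \<le> p" "p < q" "q < r" "r < s" "s \<le> n"
      "\<sigma> r < \<sigma> s" "\<sigma> s < \<sigma> p" "\<sigma> p < \<sigma> q" by blast
    let ?f = "of_one_line [p, q, r, s]"
    have "strict_mono_on {1..4} ?f"
      using o unfolding I
      by (intro strict_mono_onI) (elim insertE emptyE; simp add: w w[unfolded One_nat_def])
    moreover have "?f ` {1..4} \<subseteq> {1..n}" using o unfolding I by (simp add: w w[unfolded One_nat_def])
    moreover have "\<forall>a\<in>{1..4}. \<forall>b\<in>{1..4}.
        \<sigma> (?f a) < \<sigma> (?f b) \<longleftrightarrow> of_one_line [3, 4, 1, 2] a < of_one_line [3, 4, 1, 2] b"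
      using o unfolding I by (simp add: w w[unfolded One_nat_def])
    ultimately show ?L unfolding contains_pattern_def by blast
  qed
qed

text \<open>
  For the direction from left to right, see the argument on non-inverted pairs above: of the pairs
  \<open>p < q\<close> and \<open>\<tau> r < \<tau> s\<close>, at least one is the pair of left end points of two crossing arcs.
\<close>

lemma contains_3412_iff_crossing:
  assumes t: "\<tau> \<in> involutions n"
  shows "contains_pattern n \<tau> 4 (of_one_line [3, 4, 1, 2]) \<longleftrightarrow> (\<exists>a b. crossing_arcs \<tau> a b)"
    (is "?L \<longleftrightarrow> ?R")
proof
  have tt: "\<tau> (\<tau> k) = k" for k using involutions_facts(1)[OF t] .
  {
    assume ?L
    then obtain p q r s where o: "p < q" "q < r" "r < s" "\<tau> r < \<tau> s" "\<tau> s < \<tau> p" "\<tau> p < \<tau> q"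
      unfolding contains_3412_iff by blast
    show ?R
    proof (cases "q < \<tau> p")
      case True
      then have "crossing_arcs \<tau> p q" using o by (simp add: crossing_arcs_def)
      then show ?thesis by blast
    next
      case False
      then have "crossing_arcs \<tau> (\<tau> r) (\<tau> s)" using o by (simp add: crossing_arcs_def tt)
      then show ?thesis by blast
    qed
  }
  {
    assume ?R
    then obtain a b where c: "a < b" "b < \<tau> a" "\<tau> a < \<tau> b" unfolding crossing_arcs_def by blast
    have "1 \<le> a" "\<tau> b \<le> n"
      using c involutions_moved[OF t, of a] involutions_moved[OF t, of b]
        involutions_facts(2)[OF t, of b] by auto
    then show ?L unfolding contains_3412_iff
      using c tt by (intro exI[of _ a] exI[of _ b] exI[of _ "\<tau> a"] exI[of _ "\<tau> b"]) simp
  }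
qed

text \<open>The higher end of a down step is its left end, because no arc starts at \<open>j\<close>; so the height
  still counts the arc that the step closes.\<close>

lemma step_height_down:
  assumes t: "\<tau> \<in> involutions n" and j: "j \<in> {1..n}" "\<tau> j < j"
  shows "step_height (map (step_of \<tau>) [1..<Suc n]) j
    = int (card {k \<in> unmatched n \<tau> (j - 1). k \<le> j - 1})" (is "_ = int (card ?B)")
proof -
  have "{k \<in> unmatched n \<tau> j. k \<le> j} \<subseteq> ?B"
    using j by (auto simp: unmatched_def le_less)
  then have "card {k \<in> unmatched n \<tau> j. k \<le> j} \<le> card ?B"
    by (intro card_mono) (auto simp: unmatched_def)
  then show ?thesis
    using ycoord_eq_card[OF t, of "j - 1"] ycoord_eq_card[OF t, of j] j
    by (simp add: step_height_def del: upt_Suc)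
qed

text \<open>
  The label counts a subset of the arcs that the height counts, so equality of the two numbers
  means equality of the two sets.
\<close>

lemma label_eq_height_iff:
  assumes t: "\<tau> \<in> involutions n" and j: "j \<in> {1..n}" "\<tau> j < j"
  shows "labels_upto n \<tau> n j = Some (step_height (map (step_of \<tau>) [1..<Suc n]) j)
    \<longleftrightarrow> (\<nexists>b. crossing_arcs \<tau> (\<tau> j) b)"
proof -
  let ?A = "{k \<in> unmatched n \<tau> (j - 1). k \<le> \<tau> j}" and ?B = "{k \<in> unmatched n \<tau> (j - 1). k \<le> j - 1}"
  have tt: "\<tau> (\<tau> k) = k" for k using involutions_facts(1)[OF t] .
  have fin: "finite ?B" by (simp add: unmatched_def)
  have sub: "?A \<subseteq> ?B" using j by auto
  have "labels_upto n \<tau> n j = Some (step_height (map (step_of \<tau>) [1..<Suc n]) j)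
      \<longleftrightarrow> card ?A = card ?B"
    unfolding step_height_down[OF t j] using j by (simp add: labels_upto_def)
  also have "\<dots> \<longleftrightarrow> ?A = ?B" using card_subset_eq[OF fin sub] by auto
  also have "\<dots> \<longleftrightarrow> (\<nexists>b. crossing_arcs \<tau> (\<tau> j) b)"
  proof -
    have "b \<in> ?B - ?A \<longleftrightarrow> crossing_arcs \<tau> (\<tau> j) b" for b
    proof
      assume b: "b \<in> ?B - ?A"
      \<comment> \<open>The arc of \<open>b\<close> does not end at \<open>j\<close>, because it does not start at \<open>\<tau> j\<close>.\<close>
      then have "\<tau> b \<noteq> j" using tt by auto
      then show "crossing_arcs \<tau> (\<tau> j) b"
        using b j by (auto simp: tt unmatched_def crossing_arcs_def)
    next
      assume c: "crossing_arcs \<tau> (\<tau> j) b"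
      then have "b \<in> {1..n}"
        using involutions_moved[OF t, of b] by (simp add: crossing_arcs_def)
      then show "b \<in> ?B - ?A" using c j by (auto simp: tt unmatched_def crossing_arcs_def)
    qed
    then show ?thesis using sub by blast
  qed
  finally show ?thesis .
qed

theorem theorem7:
  fixes n :: nat and \<tau> :: "nat \<Rightarrow> nat" and M :: "step list" and l :: labelling
  assumes "\<tau> \<in> involutions n"
    and "Phi n \<tau> = (M, l)"
  shows "avoids_pattern n \<tau> 4 (of_one_line [3, 4, 1, 2]) \<longleftrightarrow> l = maximal_labelling M"
proof -
  note t = assms(1)
  have tt: "\<tau> (\<tau> k) = k" for k using involutions_facts(1)[OF t] .
  have M: "M = map (step_of \<tau>) [1..<Suc n]" and l: "l = labels_upto n \<tau> n"
    using assms(2) Phi_state[OF t order_refl] by (simp_all add: Phi_def)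
  have down: "down_steps M = {j \<in> {1..n}. \<tau> j < j}"
    unfolding M by (auto simp: down_steps_def step_of_def split: if_splits simp del: upt_Suc)
  have "l = maximal_labelling M \<longleftrightarrow>
      (\<forall>j \<in> {1..n}. \<tau> j < j \<longrightarrow> labels_upto n \<tau> n j = Some (step_height M j))"
    unfolding l by (auto simp: fun_eq_iff maximal_labelling_def down labels_upto_def)
  also have "\<dots> \<longleftrightarrow> (\<forall>j \<in> {1..n}. \<tau> j < j \<longrightarrow> (\<nexists>b. crossing_arcs \<tau> (\<tau> j) b))"
    unfolding M using label_eq_height_iff[OF t] by blast
  also have "\<dots> \<longleftrightarrow> (\<nexists>a b. crossing_arcs \<tau> a b)"
  proof -
    \<comment> \<open>The left arc of a crossing is the arc of the down step at its right end point.\<close>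
    have "\<tau> a \<in> {1..n} \<and> \<tau> (\<tau> a) < \<tau> a" if "crossing_arcs \<tau> a b" for a b
    proof -
      have "a < \<tau> a" using that by (simp add: crossing_arcs_def)
      then have "a \<in> {1..n}" using involutions_moved[OF t, of a] by simp
      then show ?thesis using involutions_facts(2)[OF t] \<open>a < \<tau> a\<close> by (simp add: tt)
    qed
    then show ?thesis using tt by metis
  qed
  also have "\<dots> \<longleftrightarrow> avoids_pattern n \<tau> 4 (of_one_line [3, 4, 1, 2])"
    unfolding avoids_pattern_def contains_3412_iff_crossing[OF t] by blast
  finally show ?thesis by blast
qed

end
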